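(* Let $G^\alpha$ be a friendship extension of a cost-minimization game $G$ with weight-bounded social cost function $C$ (with weights $w\in\mathbb R_+^N$). If $G^\alpha$ is $(\lambda,\mu)$-smooth with $\mu<1$, then the coarse price of anarchy of $G^\alpha$ is at most $\frac{\lambda}{1-\mu}$.
   Context: A cost-minimization game $G=(N,\{\Sigma_i\}_{i\in N},\{C_i\}_{i\in N})$ has a finite player set $N$, strategy sets $\Sigma_i$, profiles $\Sigma=\prod_i\Sigma_i$, and cost functions $C_i:\Sigma\to\mathbb R$; it comes with a social cost $C:\Sigma\to\mathbb R$. $(t_i,s_{-i})$ denotes $s$ with player $i$'s strategy replaced by $t_i$. $C$ is weight-bounded if $C\le\sum_iw_iC_i$ (pointwise) for some $w\in\mathbb R_+^N$. Friendship extension: for $\alpha\in[0,1]^{N\times N}$ with $\alpha_{ii}=1$ for all $i$, $G^\alpha=(N,\{\Sigma_i\},\{C_i^\alpha\})$ with $C_i^\alpha=\sum_{j\in N}\alpha_{ij}C_j$; its social cost is again $C$. Smoothness: $G^\alpha$ is $(\lambda,\mu)$-smooth if there is a (possibly randomized) strategy profile $\bar s$ such that for all $s\in\Sigma$ and all optima $s^*$ (minimizers of $C$), $$\sum_iw_i\Big(C_i(\bar s_i,s_{-i})+\sum_{j\ne i}\alpha_{ij}\big(C_j(\bar s_i,s_{-i})-C_j(s)\big)\Big)\le\lambda C(s^* )+\mu C(s),$$ where, if $\bar s$ is randomized, the left-hand side is taken in expectation over $\bar s$. A coarse equilibrium of a cost-minimization game with costs $K_i$ is a probability distribution $\sigma$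 on $\Sigma$ such that for all $i$ and all $t_i\in\Sigma_i$, $\mathbf E_{s\sim\sigma}[K_i(s)]\le\mathbf E_{s\sim\sigma}[K_i(t_i,s_{-i})]$. The coarse price of anarchy of $G^\alpha$ is $\sup_\sigma\mathbf E_{s\sim\sigma}[C(s)]/C(s^* )$, where $s^*$ minimizes $C$ and $\sigma$ ranges over the coarse equilibria of $G^\alpha$ (i.e. with $K_i=C_i^\alpha$). The optimal social cost $C(s^* )$ is assumed to be positive, so that this ratio is meaningful.
   Formalization: For infinite strategy sets it is assumed that the costs are measurable, the expectations in the definitions are finite, and each C_i^α(s̄_i, s_{-i}) has a finite expectation over independent s̄ and σ (automatic for finite games); without the last the claim can fail. *)

theory Defs
  imports "HOL-Probability.Probability"
begin

(* Every strategy set is the space of a measurable space (only "space" and "sets" of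
   "strats G i" are used), so that expectations make sense for infinite strategy sets.
   For finite strategy sets take count_space; all the measure-theoretic side conditions
   below then hold automatically, see finite_game_measurable and
   finite_game_expectations_exist. *)
record ('i, 's) cost_game =
  players :: "'i set"
  strats :: "'i \<Rightarrow> 's measure"
  cost :: "'i \<Rightarrow> ('i \<Rightarrow> 's) \<Rightarrow> real"
  social :: "('i \<Rightarrow> 's) \<Rightarrow> real"

definition profile_algebra :: "('i, 's) cost_game \<Rightarrow> ('i \<Rightarrow> 's) measure" where
  "profile_algebra G = Pi\<^sub>M (players G) (strats G)"

definition profiles :: "('i, 's) cost_game \<Rightarrow> ('i \<Rightarrow> 's) set" where
  "profiles G = (\<Pi>\<^sub>E i\<in>players G. space (strats G i))"

definition cost_minimization_game :: "('i, 's) cost_game \<Rightarrow> bool" where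
  "cost_minimization_game G \<longleftrightarrow>
     finite (players G) \<and>
     (\<forall>i\<in>players G. cost G i \<in> borel_measurable (profile_algebra G)) \<and>
     social G \<in> borel_measurable (profile_algebra G)"

definition profile_distribution :: "('i, 's) cost_game \<Rightarrow> ('i \<Rightarrow> 's) measure \<Rightarrow> bool" where
  "profile_distribution G D \<longleftrightarrow> prob_space D \<and> sets D = sets (profile_algebra G)"

definition weight_bounded :: "('i, 's) cost_game \<Rightarrow> ('i \<Rightarrow> real) \<Rightarrow> bool" where
  "weight_bounded G w \<longleftrightarrow>
     (\<forall>i\<in>players G. 0 \<le> w i) \<and>
     (\<forall>s\<in>profiles G. social G s \<le> (\<Sum>i\<in>players G. w i * cost G i s))"

definition friendship :: "('i, 's) cost_game \<Rightarrow> ('i \<Rightarrow> 'i \<Rightarrow> real) \<Rightarrow> bool" where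
  "friendship G \<alpha> \<longleftrightarrow>
     (\<forall>i\<in>players G. \<forall>j\<in>players G. \<alpha> i j \<in> {0..1}) \<and> (\<forall>i\<in>players G. \<alpha> i i = 1)"

definition friendship_extension ::
    "('i, 's) cost_game \<Rightarrow> ('i \<Rightarrow> 'i \<Rightarrow> real) \<Rightarrow> ('i, 's) cost_game" where
  "friendship_extension G \<alpha> = G\<lparr>cost := (\<lambda>i s. \<Sum>j\<in>players G. \<alpha> i j * cost G j s)\<rparr>"

definition optimum :: "('i, 's) cost_game \<Rightarrow> ('i \<Rightarrow> 's) \<Rightarrow> bool" where
  "optimum G s \<longleftrightarrow> is_arg_min (social G) (\<lambda>s. s \<in> profiles G) s"

definition optimal_cost :: "('i, 's) cost_game \<Rightarrow> real" where
  "optimal_cost G = social G (SOME s. optimum G s)"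

(* The friendship extension of G is (l, m)-smooth iff smooth_with G \<alpha> w l m D for some D.
   D is the law of the randomized profile; a deterministic profile x is the case
   D = return (profile_algebra G) x.  Each summand only depends on one component of the
   randomized profile, so it is immaterial whether the components are independent. *)
definition smooth_with ::
    "('i, 's) cost_game \<Rightarrow> ('i \<Rightarrow> 'i \<Rightarrow> real) \<Rightarrow> ('i \<Rightarrow> real) \<Rightarrow> real \<Rightarrow> real \<Rightarrow>
     ('i \<Rightarrow> 's) measure \<Rightarrow> bool" where
  "smooth_with G \<alpha> w l m D \<longleftrightarrow>
     profile_distribution G D \<and>
     (\<forall>s\<in>profiles G. \<forall>opt. optimum G opt \<longrightarrow>
       (let L = (\<lambda>t. \<Sum>i\<in>players G. w i *
                  (cost G i (s(i := t i)) +
                   (\<Sum>j\<in>players G - {i}. \<alpha> i j * (cost G j (s(i := t i)) - cost G j s))))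
        in integrable D L \<and> (\<integral>t. L t \<partial>D) \<le> l * social G opt + m * social G s))"

definition coarse_equilibrium :: "('i, 's) cost_game \<Rightarrow> ('i \<Rightarrow> 's) measure \<Rightarrow> bool" where
  "coarse_equilibrium G \<sigma> \<longleftrightarrow>
     profile_distribution G \<sigma> \<and>
     (\<forall>i\<in>players G. integrable \<sigma> (cost G i) \<and>
       (\<forall>t\<in>space (strats G i).
          integrable \<sigma> (\<lambda>s. cost G i (s(i := t))) \<and>
          (\<integral>s. cost G i s \<partial>\<sigma>) \<le> (\<integral>s. cost G i (s(i := t)) \<partial>\<sigma>)))"

(* The nonnegative integral keeps an infinite expected social cost visible as infinity.
   It truncates negative values, so this is meaningful only for a positive optimal cost.
   The supremum is taken in the extended reals. *)
definition coarse_price_of_anarchy :: "('i, 's) cost_game \<Rightarrow> ereal" where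
  "coarse_price_of_anarchy G =
     (SUP \<sigma>\<in>{\<sigma>. coarse_equilibrium G \<sigma>}.
        enn2ereal (\<integral>\<^sup>+ s. ennreal (social G s) \<partial>\<sigma>) / ereal (optimal_cost G))"

(* The expectation of every deviation cost over a randomized profile t ~ D and an
   independent s ~ \<sigma> exists, so that the two expectations may be interchanged.
   This is not implied by the existence of the iterated expectations; it holds whenever
   the costs are bounded, in particular in finite games, and for deterministic D in every
   game, see finite_game_expectations_exist and deterministic_expectations_exist. *)
definition deviation_expectations_exist ::
    "('i, 's) cost_game \<Rightarrow> ('i \<Rightarrow> 's) measure \<Rightarrow> ('i \<Rightarrow> 's) measure \<Rightarrow> bool" where
  "deviation_expectations_exist G D \<sigma> \<longleftrightarrow>
     (\<forall>i\<in>players G. integrable (D \<Otimes>\<^sub>M \<sigma>) (\<lambda>(t, s). cost G i (s(i := t i))))"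

lemma profile_algebra_finite_game:
  assumes "finite (players G)"
    and "\<And>i. i \<in> players G \<Longrightarrow> finite (S i) \<and> strats G i = count_space (S i)"
  shows "profile_algebra G = count_space (profiles G)"
proof -
  let ?S = "\<lambda>i. if i \<in> players G then S i else {}"
  have "profile_algebra G = Pi\<^sub>M (players G) (\<lambda>i. count_space (?S i))"
    unfolding profile_algebra_def using assms(2) by (intro PiM_cong) auto
  also have "\<dots> = count_space (Pi\<^sub>E (players G) ?S)"
    by (rule count_space_PiM_finite[OF assms(1)]) (simp add: assms(2) countable_finite)
  also have "Pi\<^sub>E (players G) ?S = profiles G"
    unfolding profiles_def using assms(2) by (intro PiE_cong) auto
  finally show ?thesis .
qed

lemma finite_game_measurable:
  assumes "finite (players G)"
    and "\<And>i. i \<in> players G \<Longrightarrow> finite (S i) \<and> strats G i = count_space (S i)"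
  shows "cost_minimization_game G"
  using assms(1) profile_algebra_finite_game[OF assms]
  by (simp add: cost_minimization_game_def)

lemma finite_game_expectations_exist:
  assumes fin: "finite (players G)"
    and strats: "\<And>i. i \<in> players G \<Longrightarrow> finite (S i) \<and> strats G i = count_space (S i)"
    and D: "profile_distribution G D" and \<sigma>: "profile_distribution G \<sigma>"
  shows "deviation_expectations_exist G D \<sigma>"
proof -
  have PA: "profile_algebra G = count_space (profiles G)"
    by (rule profile_algebra_finite_game[OF fin strats])
  have finP: "finite (profiles G)"
    unfolding profiles_def using fin strats by (intro finite_PiE) auto
  interpret D: prob_space D using D by (simp add: profile_distribution_def)
  interpret s: prob_space \<sigma> using \<sigma> by (simp add: profile_distribution_def)
  interpret P: pair_prob_space D \<sigma> ..
  have sets: "sets (D \<Otimes>\<^sub>M \<sigma>) = sets (count_space (profiles G \<times> profiles G))"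
  proof -
    have "sets (D \<Otimes>\<^sub>M \<sigma>) = sets (count_space (profiles G) \<Otimes>\<^sub>M count_space (profiles G))"
      using D \<sigma> PA by (intro sets_pair_measure_cong) (auto simp: profile_distribution_def)
    also have "\<dots> = sets (count_space (profiles G \<times> profiles G))"
      by (simp only: pair_measure_countable[OF countable_finite[OF finP] countable_finite[OF finP]])
    finally show ?thesis .
  qed
  have "integrable (D \<Otimes>\<^sub>M \<sigma>) f" for f :: "_ \<Rightarrow> real"
  proof (rule P.integrable_const_bound)
    show "AE x in D \<Otimes>\<^sub>M \<sigma>. norm (f x) \<le> (\<Sum>y\<in>profiles G \<times> profiles G. \<bar>f y\<bar>)"
    proof (rule AE_I2)
      fix x assume "x \<in> space (D \<Otimes>\<^sub>M \<sigma>)"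
      then have "x \<in> profiles G \<times> profiles G"
        using sets_eq_imp_space_eq[OF sets] by (simp only: space_count_space)
      then show "norm (f x) \<le> (\<Sum>y\<in>profiles G \<times> profiles G. \<bar>f y\<bar>)"
        using finP member_le_sum[of x "profiles G \<times> profiles G" "\<lambda>y. \<bar>f y\<bar>"] by simp
    qed
    show "f \<in> borel_measurable (D \<Otimes>\<^sub>M \<sigma>)"
      unfolding measurable_cong_sets[OF sets refl] by simp
  qed
  then show ?thesis unfolding deviation_expectations_exist_def by blast
qed

lemma deviation_measurable:
  assumes "cost_minimization_game G" "i \<in> players G"
  shows "(\<lambda>(t, s). cost G i (s(i := t i))) \<in>
           borel_measurable (profile_algebra G \<Otimes>\<^sub>M profile_algebra G)"
proof -
  have cost: "cost G i \<in> borel_measurable (profile_algebra G)"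
    using assms by (simp add: cost_minimization_game_def)
  have ins: "insert i (players G) = players G" using assms(2) by auto
  have "(\<lambda>x. (snd x)(i := fst x i)) \<in>
          measurable (profile_algebra G \<Otimes>\<^sub>M profile_algebra G) (profile_algebra G)"
    unfolding profile_algebra_def
  proof (rule measurable_fun_upd[where J = "players G"])
    show "players G = players G \<union> {i}" using assms(2) by auto
    show "snd \<in> measurable (Pi\<^sub>M (players G) (strats G) \<Otimes>\<^sub>M Pi\<^sub>M (players G) (strats G))
        (Pi\<^sub>M (players G) (strats G))" by simp
    show "(\<lambda>x. fst x i) \<in> measurable (Pi\<^sub>M (players G) (strats G) \<Otimes>\<^sub>M
        Pi\<^sub>M (players G) (strats G)) (strats G i)"
      using assms(2) by (rule measurable_compose[OF measurable_fst measurable_component_singleton])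
  qed
  from measurable_compose[OF this cost] show ?thesis by (simp add: case_prod_beta)
qed

lemma deterministic_expectations_exist:
  assumes G: "cost_minimization_game G" and x: "x \<in> profiles G"
    and \<sigma>: "coarse_equilibrium G \<sigma>"
  shows "deviation_expectations_exist G (return (profile_algebra G) x) \<sigma>"
  unfolding deviation_expectations_exist_def
proof
  fix i assume i: "i \<in> players G"
  let ?D = "return (profile_algebra G) x"
  let ?f = "\<lambda>(t, s). cost G i (s(i := t i))"
  have xs: "x \<in> space (profile_algebra G)"
    using x by (simp add: profiles_def profile_algebra_def space_PiM)
  have pd: "prob_space \<sigma>" "sets \<sigma> = sets (profile_algebra G)"
    using \<sigma> by (auto simp: coarse_equilibrium_def profile_distribution_def)
  interpret s: prob_space \<sigma> by fact
  interpret D: prob_space ?D by (rule prob_space_return[OF xs])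
  interpret P: pair_prob_space ?D \<sigma> ..
  have m: "?f \<in> borel_measurable (?D \<Otimes>\<^sub>M \<sigma>)"
    using deviation_measurable[OF G i] pd(2)
    by (simp add: measurable_cong_sets[OF sets_pair_measure_cong[OF sets_return pd(2)] refl])
  have xi: "x i \<in> space (strats G i)" using x i by (auto simp: profiles_def)
  have int: "integrable \<sigma> (\<lambda>s. cost G i (s(i := x i)))"
    using \<sigma> i xi by (auto simp: coarse_equilibrium_def)
  have m': "(\<lambda>z. ennreal (norm (?f z))) \<in> borel_measurable (?D \<Otimes>\<^sub>M \<sigma>)"
    by (rule measurable_compose[OF measurable_compose[OF m borel_measurable_norm] measurable_ennreal])
  have mm: "(\<lambda>t. \<integral>\<^sup>+ s. ennreal (norm (?f (t, s))) \<partial>\<sigma>) \<in> borel_measurable (profile_algebra G)"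
    using s.borel_measurable_nn_integral_fst[OF m'] by simp
  have "(\<integral>\<^sup>+ z. ennreal (norm (?f z)) \<partial>(?D \<Otimes>\<^sub>M \<sigma>)) =
        (\<integral>\<^sup>+ t. (\<integral>\<^sup>+ s. ennreal (norm (?f (t, s))) \<partial>\<sigma>) \<partial>?D)"
    by (rule s.nn_integral_fst[OF m', symmetric])
  also have "\<dots> = (\<integral>\<^sup>+ s. ennreal (norm (?f (x, s))) \<partial>\<sigma>)"
    by (rule nn_integral_return[OF xs mm])
  also have "\<dots> < \<infinity>"
    using int by (simp add: integrable_iff_bounded)
  finally show "integrable (?D \<Otimes>\<^sub>M \<sigma>) ?f"
    using m by (simp add: integrable_iff_bounded)
qed

end

theory Submission
  imports Defs
begin

text \<open>
  Write \<open>K\<^sub>i\<close> for the cost functions of the friendship extension. As \<open>\<alpha>\<^sub>i\<^sub>i = 1\<close>, the summand of player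
  \<open>i\<close> in the smoothness condition is \<open>w\<^sub>i * (K\<^sub>i(t\<^sub>i, s\<^sub>-\<^sub>i) - K\<^sub>i(s) + C\<^sub>i(s))\<close>, so weight-boundedness gives
  \<open>(1 - \<mu>) * C(s) \<le> \<lambda> * C(s\<^sup>*) + (\<Sum>i. w\<^sub>i * (K\<^sub>i(s) - E\<^sub>t[K\<^sub>i(t\<^sub>i, s\<^sub>-\<^sub>i)]))\<close> pointwise.
  Only \<open>K\<^sub>i\<close>, not \<open>C\<^sub>i\<close> itself, needs to be integrable here. Averaging over a coarse equilibrium and
  exchanging the two expectations makes the sum nonpositive.
\<close>

lemma friendship_extension_simps [simp]:
  "players (friendship_extension G \<alpha>) = players G"
  "strats (friendship_extension G \<alpha>) = strats G"
  "social (friendship_extension G \<alpha>) = social G"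
  "profiles (friendship_extension G \<alpha>) = profiles G"
  "profile_algebra (friendship_extension G \<alpha>) = profile_algebra G"
  "optimal_cost (friendship_extension G \<alpha>) = optimal_cost G"
  by (simp_all add: friendship_extension_def profiles_def profile_algebra_def
      optimal_cost_def optimum_def)

lemma profile_distribution_space:
  assumes "profile_distribution G D"
  shows "space D = profiles G"
  using assms sets_eq_imp_space_eq[of D "profile_algebra G"]
  by (simp add: profile_distribution_def profile_algebra_def profiles_def space_PiM)

text \<open>The choice operator in \<open>optimal_cost\<close> is known to return an optimum only
  once some optimum exists.\<close>

lemma optimal_cost_attained:
  assumes "\<exists>s. optimum G s"
  obtains opt where "optimum G opt" "social G opt = optimal_cost G"
  using someI_ex[OF assms] by (auto simp: optimal_cost_def)

lemma optimum_le:
  assumes "optimum G opt" "s \<in> profiles G"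
  shows "social G opt \<le> social G s"
  using assms by (auto simp: optimum_def is_arg_min_linorder)

text \<open>The sum over \<open>j \<noteq> i\<close> lacks only the difference of player
  \<open>i\<close>'s own costs. Adding and subtracting \<open>cost G i s\<close> supplies it, with
  the right coefficient because \<open>\<alpha> i i = 1\<close>.\<close>

lemma smoothness_summand:
  assumes "finite (players G)" "friendship G \<alpha>" "i \<in> players G"
  shows "cost G i s' + (\<Sum>j\<in>players G - {i}. \<alpha> i j * (cost G j s' - cost G j s)) =
    cost (friendship_extension G \<alpha>) i s' - cost (friendship_extension G \<alpha>) i s + cost G i s"
proof -
  have "\<alpha> i i = 1" using assms by (auto simp: friendship_def)
  then have "cost (friendship_extension G \<alpha>) i x =
      cost G i x + (\<Sum>j\<in>players G - {i}. \<alpha> i j * cost G j x)" for x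
    using assms by (simp add: friendship_extension_def sum.remove)
  then show ?thesis by (simp add: algebra_simps sum_subtractf)
qed

text \<open>The equilibrium inequality holds for each fixed deviation \<open>t i\<close>, hence also
  after averaging over \<open>t\<close>; Fubini then moves the average over \<open>t\<close> inside.
  Fubini yields integrability in \<open>t\<close> only for almost every \<open>s\<close>, hence the
  form of the first claim.\<close>

lemma coarse_equilibrium_randomized_deviation:
  assumes eq: "coarse_equilibrium G \<sigma>" and D: "profile_distribution G D"
    and dev: "deviation_expectations_exist G D \<sigma>" and i: "i \<in> players G"
  shows "AE s in \<sigma>. integrable D (\<lambda>t. cost G i (s(i := t i)))"
    and "integrable \<sigma> (\<lambda>s. \<integral>t. cost G i (s(i := t i)) \<partial>D)"
    and "(\<integral>s. cost G i s \<partial>\<sigma>) \<le> (\<integral>s. (\<integral>t. cost G i (s(i := t i)) \<partial>D) \<partial>\<sigma>)"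
proof -
  interpret D: prob_space D using D by (simp add: profile_distribution_def)
  interpret s: prob_space \<sigma>
    using eq by (simp add: coarse_equilibrium_def profile_distribution_def)
  interpret P: pair_prob_space D \<sigma> ..
  have int: "integrable (D \<Otimes>\<^sub>M \<sigma>) (\<lambda>(t, s). cost G i (s(i := t i)))"
    using dev i by (auto simp: deviation_expectations_exist_def)
  show "AE s in \<sigma>. integrable D (\<lambda>t. cost G i (s(i := t i)))"
    by (rule P.AE_integrable_snd[OF int])
  show "integrable \<sigma> (\<lambda>s. \<integral>t. cost G i (s(i := t i)) \<partial>D)"
    by (rule P.integrable_snd[OF int])
  \<comment> \<open>The equilibrium cost is written as an average over \<open>D\<close> so that the
    two sides can be compared for each \<open>t\<close>.\<close>
  have "(\<integral>s. cost G i s \<partial>\<sigma>) = (\<integral>t. (\<integral>s. cost G i s \<partial>\<sigma>) \<partial>D)"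
    by (simp add: D.prob_space)
  also have "\<dots> \<le> (\<integral>t. (\<integral>s. cost G i (s(i := t i)) \<partial>\<sigma>) \<partial>D)"
  proof (rule integral_mono)
    show "integrable D (\<lambda>t. \<integral>s. cost G i (s(i := t i)) \<partial>\<sigma>)"
      by (rule P.integrable_fst[OF int])
    fix t assume "t \<in> space D"
    then have "t i \<in> space (strats G i)"
      using i by (auto simp: profile_distribution_space[OF D] profiles_def)
    then show "(\<integral>s. cost G i s \<partial>\<sigma>) \<le> (\<integral>s. cost G i (s(i := t i)) \<partial>\<sigma>)"
      using eq i by (auto simp: coarse_equilibrium_def)
  qed simp
  also have "\<dots> = (\<integral>s. (\<integral>t. cost G i (s(i := t i)) \<partial>D) \<partial>\<sigma>)"
    by (rule P.Fubini_integral[OF int, symmetric])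
  finally show "(\<integral>s. cost G i s \<partial>\<sigma>) \<le> (\<integral>s. (\<integral>t. cost G i (s(i := t i)) \<partial>D) \<partial>\<sigma>)" .
qed

text \<open>Smoothness makes only the weighted sum over all players integrable. Splitting its
  integral player by player needs each deviation cost to be integrable at this particular
  \<open>s\<close>, which is the hypothesis \<open>int\<close>.\<close>

lemma smooth_pointwise:
  fixes G \<alpha>
  defines "K \<equiv> cost (friendship_extension G \<alpha>)"
  assumes fin: "finite (players G)" and fr: "friendship G \<alpha>" and wb: "weight_bounded G w"
    and sm: "smooth_with G \<alpha> w l m D" and s: "s \<in> profiles G" and opt: "optimum G opt"
    and int: "\<And>i. i \<in> players G \<Longrightarrow> integrable D (\<lambda>t. K i (s(i := t i)))"
  shows "(1 - m) * social G s \<le> l * social G opt +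
    (\<Sum>i\<in>players G. w i * (K i s - (\<integral>t. K i (s(i := t i)) \<partial>D)))"
proof -
  interpret D: prob_space D
    using sm by (simp add: smooth_with_def profile_distribution_def)
  let ?L = "\<lambda>t. \<Sum>i\<in>players G. w i * (cost G i (s(i := t i)) +
    (\<Sum>j\<in>players G - {i}. \<alpha> i j * (cost G j (s(i := t i)) - cost G j s)))"
  have "?L = (\<lambda>t. \<Sum>i\<in>players G. w i * (K i (s(i := t i)) - K i s + cost G i s))"
    unfolding K_def using smoothness_summand[OF fin fr] by simp
  \<comment> \<open>The terms \<open>K i s\<close> and \<open>cost G i s\<close> do not depend on
    \<open>t\<close> and survive unchanged, since \<open>D\<close> has total mass one.\<close>
  then have "(\<integral>t. ?L t \<partial>D) =
      (\<Sum>i\<in>players G. w i * ((\<integral>t. K i (s(i := t i)) \<partial>D) - K i s + cost G i s))"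
    using int by (simp add: D.prob_space)
  moreover have "(\<integral>t. ?L t \<partial>D) \<le> l * social G opt + m * social G s"
    using sm s opt by (simp add: smooth_with_def Let_def)
  moreover have "social G s \<le> (\<Sum>i\<in>players G. w i * cost G i s)"
    using wb s by (simp add: weight_bounded_def)
  ultimately show ?thesis
    by (simp add: algebra_simps sum.distrib sum_subtractf)
qed

lemma coarse_equilibrium_expected_social_cost:
  assumes G: "cost_minimization_game G" and fr: "friendship G \<alpha>" and wb: "weight_bounded G w"
    and opt: "optimum G opt" and pos: "social G opt \<ge> 0"
    and sm: "smooth_with G \<alpha> w l m D" and m: "m < 1"
    and eq: "coarse_equilibrium (friendship_extension G \<alpha>) \<sigma>"
    and dev: "deviation_expectations_exist (friendship_extension G \<alpha>) D \<sigma>"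
  shows "integrable \<sigma> (social G)"
    and "(\<integral>s. social G s \<partial>\<sigma>) \<le> l / (1 - m) * social G opt"
proof -
  let ?F = "friendship_extension G \<alpha>"
  let ?K = "cost ?F"
  let ?E = "\<lambda>i s. \<integral>t. ?K i (s(i := t i)) \<partial>D"
  let ?R = "\<lambda>s. (l * social G opt + (\<Sum>i\<in>players G. w i * (?K i s - ?E i s))) / (1 - m)"
  have fin: "finite (players G)" using G by (simp add: cost_minimization_game_def)
  have D: "profile_distribution ?F D"
    using sm by (simp add: smooth_with_def profile_distribution_def)
  have \<sigma>: "profile_distribution ?F \<sigma>" using eq by (simp add: coarse_equilibrium_def)
  interpret \<sigma>: prob_space \<sigma> using \<sigma> by (simp add: profile_distribution_def)
  note space = profile_distribution_space[OF \<sigma>, simplified]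
  have intK: "integrable \<sigma> (?K i)" if "i \<in> players G" for i
    using eq that by (simp add: coarse_equilibrium_def)
  note devs = coarse_equilibrium_randomized_deviation[OF eq D dev, simplified]
  \<comment> \<open>Finitely many players allow one null set to serve all of them.\<close>
  have AE_int: "AE s in \<sigma>. \<forall>i\<in>players G. integrable D (\<lambda>t. ?K i (s(i := t i)))"
    using devs(1) by (simp add: AE_finite_all[OF fin])
  have bound: "AE s in \<sigma>. social G s \<le> ?R s"
    using AE_int
  proof (rule AE_mp, intro AE_I2 impI)
    fix s assume s: "s \<in> space \<sigma>"
      and int: "\<forall>i\<in>players G. integrable D (\<lambda>t. ?K i (s(i := t i)))"
    show "social G s \<le> ?R s"
      using smooth_pointwise[OF fin fr wb sm _ opt] s int m
      by (simp add: space pos_le_divide_eq mult.commute)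
  qed
  have intR: "integrable \<sigma> ?R"
    using intK devs(2) by simp
  \<comment> \<open>Integrability comes from domination:
    \<open>0 \<le> social G opt \<le> social G s\<close> on profiles, and \<open>?R\<close> is an
    integrable upper bound almost everywhere.\<close>
  show int: "integrable \<sigma> (social G)"
  proof (rule Bochner_Integration.integrable_bound[OF intR])
    show "social G \<in> borel_measurable \<sigma>"
      using G \<sigma> by (simp add: cost_minimization_game_def profile_distribution_def
          measurable_cong_sets[OF _ refl, of \<sigma> "profile_algebra G"])
    have "AE s in \<sigma>. 0 \<le> social G s"
      using optimum_le[OF opt] pos by (intro AE_I2) (force simp: space)
    with bound show "AE s in \<sigma>. norm (social G s) \<le> norm (?R s)"
      by eventually_elim (simp only: real_norm_def abs_of_nonneg order.trans[OF _ abs_ge_self])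
  qed
  have "(\<integral>s. social G s \<partial>\<sigma>) \<le> (\<integral>s. ?R s \<partial>\<sigma>)"
    by (rule integral_mono_AE[OF int intR bound])
  also have "\<dots> = (l * social G opt +
      (\<Sum>i\<in>players G. w i * ((\<integral>s. ?K i s \<partial>\<sigma>) - (\<integral>s. ?E i s \<partial>\<sigma>)))) / (1 - m)"
    using intK devs(2) by (simp add: \<sigma>.prob_space)
  \<comment> \<open>Each summand is a nonnegative weight times a difference that the equilibrium
    property makes nonpositive.\<close>
  also have "\<dots> \<le> (l * social G opt + 0) / (1 - m)"
    using m wb devs(3)
    by (intro divide_right_mono add_left_mono sum_nonpos mult_nonneg_nonpos)
      (auto simp: weight_bounded_def)
  finally show "(\<integral>s. social G s \<partial>\<sigma>) \<le> l / (1 - m) * social G opt" by simp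
qed

theorem theorem2:
  fixes G :: "('i, 's) cost_game"
    and \<alpha> :: "'i \<Rightarrow> 'i \<Rightarrow> real"
    and w :: "'i \<Rightarrow> real"
    and l m :: real
    and sbar :: "('i \<Rightarrow> 's) measure"
  assumes "cost_minimization_game G"
    and "friendship G \<alpha>"
    and "weight_bounded G w"
    and "\<exists>s. optimum G s"
    and "optimal_cost G > 0"
    and "smooth_with G \<alpha> w l m sbar"
    and "m < 1"
    and "\<And>\<sigma>. coarse_equilibrium (friendship_extension G \<alpha>) \<sigma> \<Longrightarrow>
           deviation_expectations_exist (friendship_extension G \<alpha>) sbar \<sigma>"
  shows "coarse_price_of_anarchy (friendship_extension G \<alpha>) \<le> ereal (l / (1 - m))"
  unfolding coarse_price_of_anarchy_def
proof (rule SUP_least)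
  let ?F = "friendship_extension G \<alpha>"
  fix \<sigma> assume "\<sigma> \<in> {\<sigma>. coarse_equilibrium ?F \<sigma>}"
  then have eq: "coarse_equilibrium ?F \<sigma>" by simp
  then have space: "space \<sigma> = profiles G"
    using profile_distribution_space[of ?F \<sigma>] by (simp add: coarse_equilibrium_def)
  obtain opt where opt: "optimum G opt" "social G opt = optimal_cost G"
    using optimal_cost_attained[OF assms(4)] .
  have pos: "social G opt \<ge> 0" using opt(2) assms(5) by simp
  note E = coarse_equilibrium_expected_social_cost[OF assms(1-3) opt(1) pos assms(6,7) eq
      assms(8)[OF eq]]
  have nonneg: "0 \<le> social G s" if "s \<in> space \<sigma>" for s
    using optimum_le[OF opt(1), of s] pos that space by simp
  \<comment> \<open>The truncation in the nonnegative integral has no effect, because the social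
    cost of every profile is at least the positive optimal cost.\<close>
  have "(\<integral>\<^sup>+ s. ennreal (social G s) \<partial>\<sigma>) = ennreal (\<integral>s. social G s \<partial>\<sigma>)"
    by (rule nn_integral_eq_integral[OF E(1) AE_I2[OF nonneg]])
  moreover have "0 \<le> (\<integral>s. social G s \<partial>\<sigma>)"
    by (rule Bochner_Integration.integral_nonneg[OF nonneg])
  ultimately show "enn2ereal (\<integral>\<^sup>+ s. ennreal (social ?F s) \<partial>\<sigma>) / ereal (optimal_cost ?F)
      \<le> ereal (l / (1 - m))"
    using E(2) assms(5) by (simp add: opt(2) enn2ereal_ennreal pos_divide_le_eq)
qed

end
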